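(* Let $V(r) = -M_\mu r^\mu + \frac12 \Lambda_{\mu\nu} r^\mu r^\nu$ be a two-Higgs-doublet potential on $LC^+$, where $M_\mu$ is a real four-vector and $\Lambda_{\mu\nu}$ is a real symmetric tensor with $\Lambda_{\mu\nu} r^\mu r^\nu>0$ for all $r\in LC^+\setminus\{0\}$. Suppose that the vacuum is twice degenerate, i.e. the global minimum of $V$ on $LC^+$ is attained at exactly two distinct points. Then this is the result of spontaneous violation of a discrete $\mathbb{Z}_2$ symmetry of the potential: there exists an explicit symmetry $T$ of the potential with $T\neq \mathrm{id}$, $T^2=\mathrm{id}$, which does not leave the two global minimum points fixed but maps them onto each other.
   Context: Work in $\mathbb{R}^4$ with coordinates $r^\mu = (r_0, r_1, r_2, r_3)$ and Minkowski metric $g = \mathrm{diag}(1,-1,-1,-1)$. The orbit space is the closed forward lightcone (surface and interior) $LC^+ = \{ r \in \mathbb{R}^4 : r_0 \ge 0,\ r_0^2 - r_1^2 - r_2^2 - r_3^2 \ge 0\}$. The vacuum is the global minimum of $V$ on $LC^+$, and its degeneracy is the number of points of $LC^+$ at which it is attained. An explicit symmetry of the potential is an invertible linear map $T$ of $\mathbb{R}^4$ with $T(LC^+)=LC^+$ that leaves invariant, separately, the quadratic form $\Lambda_{\mu\nu} r^\mu r^\nu$ and the linear form $M_\mu r^\mu$. It is spontaneously violated at a global minimum point $\langle r\rangle$ if $T\langle r\rangle\ne\langle r\rangle$. *)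

theory Defs
  imports "HOL-Analysis.Analysis"
begin

(* Vectors are indexed by the four elements 0, 1, 2, 3 of the numeral type 4; there 4 = 0,
   so r $ 0 is the time component and no component is missed. *)

definition LC_plus :: "(real ^ 4) set" where
  "LC_plus = {r. r $ 0 \<ge> 0 \<and> (r $ 0)\<^sup>2 - (r $ 1)\<^sup>2 - (r $ 2)\<^sup>2 - (r $ 3)\<^sup>2 \<ge> 0}"

(* M and \<Lambda> hold the components with lower indices, r those with upper indices,
   so the contractions are plain sums without the metric. *)

definition linear_form :: "real ^ 4 \<Rightarrow> real ^ 4 \<Rightarrow> real" where
  "linear_form M r = (\<Sum>\<mu>\<in>UNIV. M $ \<mu> * r $ \<mu>)"

definition quadratic_form :: "real ^ 4 ^ 4 \<Rightarrow> real ^ 4 \<Rightarrow> real" where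
  "quadratic_form \<Lambda> r = (\<Sum>\<mu>\<in>UNIV. \<Sum>\<nu>\<in>UNIV. \<Lambda> $ \<mu> $ \<nu> * r $ \<mu> * r $ \<nu>)"

definition potential :: "real ^ 4 \<Rightarrow> real ^ 4 ^ 4 \<Rightarrow> real ^ 4 \<Rightarrow> real" where
  "potential M \<Lambda> r = - linear_form M r + 1 / 2 * quadratic_form \<Lambda> r"

definition vacua :: "real ^ 4 \<Rightarrow> real ^ 4 ^ 4 \<Rightarrow> (real ^ 4) set" where
  "vacua M \<Lambda> = {r. is_arg_min (potential M \<Lambda>) (\<lambda>s. s \<in> LC_plus) r}"

definition explicit_symmetry ::
  "real ^ 4 \<Rightarrow> real ^ 4 ^ 4 \<Rightarrow> (real ^ 4 \<Rightarrow> real ^ 4) \<Rightarrow> bool" where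
  "explicit_symmetry M \<Lambda> T \<longleftrightarrow>
     linear T \<and> bij T \<and> T ` LC_plus = LC_plus \<and>
     (\<forall>r. quadratic_form \<Lambda> (T r) = quadratic_form \<Lambda> r) \<and>
     (\<forall>r. linear_form M (T r) = linear_form M r)"

definition spontaneously_violated ::
  "real ^ 4 \<Rightarrow> real ^ 4 ^ 4 \<Rightarrow> (real ^ 4 \<Rightarrow> real ^ 4) \<Rightarrow> real ^ 4 \<Rightarrow> bool" where
  "spontaneously_violated M \<Lambda> T r \<longleftrightarrow>
     explicit_symmetry M \<Lambda> T \<and> r \<in> vacua M \<Lambda> \<and> T r \<noteq> r"

end

theory Submission
  imports Defs
begin

text \<open>The potential is quadratic along the line through the two minima, with equal values at both.
  Without a third minimum on the segment it is strictly concave there and drops below the minimum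
  beyond both ends, so the line leaves the cone at both minima. This excludes interior minima, and
  positivity of \<open>\<Lambda>\<close> on the ray through the other minimum excludes the apex.
  Hence both minima \<open>r\<^sub>1\<close>, \<open>r\<^sub>2\<close> are null, and each comes
  with a Lagrange multiplier, \<open>\<Lambda> r\<^sub>i - M = \<lambda>\<^sub>i g r\<^sub>i\<close>. Contracting with the other minimum gives
  \<open>\<lambda>\<^sub>1 = \<lambda>\<^sub>2 = \<lambda>\<close>, so the spacelike vector \<open>d = r\<^sub>2 - r\<^sub>1\<close> is in the kernel of \<open>\<Lambda> - \<lambda> g\<close> and
  orthogonal to \<open>M\<close>. The Minkowski reflection along \<open>d\<close> is the required symmetry.\<close>

section \<open>Minkowski geometry of the forward light cone\<close>

text \<open>The metric \<open>diag (1, -1, -1, -1)\<close> written through the Euclidean inner product, which turns the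
  cone condition into the norm bound \<open>norm r \<le> sqrt 2 * r $ 0\<close>.\<close>

definition mink :: "real ^ 4 \<Rightarrow> real ^ 4 \<Rightarrow> real" where
  "mink x y = 2 * x $ 0 * y $ 0 - x \<bullet> y"

lemma mink_commute: "mink x y = mink y x"
  by (simp add: mink_def inner_commute)

lemma mink_simps:
  "mink (x + y) z = mink x z + mink y z" "mink z (x + y) = mink z x + mink z y"
  "mink (x - y) z = mink x z - mink y z" "mink z (x - y) = mink z x - mink z y"
  "mink (c *\<^sub>R x) z = c * mink x z" "mink z (c *\<^sub>R x) = c * mink z x"
  "mink (- x) z = - mink x z" "mink z (- x) = - mink z x"
  by (simp_all add: mink_def inner_simps algebra_simps)

lemma LC_plus_iff_mink: "r \<in> LC_plus \<longleftrightarrow> 0 \<le> r $ 0 \<and> 0 \<le> mink r r"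
proof -
  have "(4::4) = 0" by simp
  then have time: "r $ 4 = r $ 0" by metis
  have "mink r r = (r $ 0)\<^sup>2 - (r $ 1)\<^sup>2 - (r $ 2)\<^sup>2 - (r $ 3)\<^sup>2"
    unfolding mink_def inner_vec_def sum_4 time power2_eq_square by simp
  then show ?thesis by (simp add: LC_plus_def)
qed

lemma mink_nonneg_iff_norm: "0 \<le> mink x x \<longleftrightarrow> norm x \<le> sqrt 2 * \<bar>x $ 0\<bar>"
proof -
  have "norm x \<le> sqrt 2 * \<bar>x $ 0\<bar> \<longleftrightarrow> (norm x)\<^sup>2 \<le> (sqrt 2 * \<bar>x $ 0\<bar>)\<^sup>2"
    by simp
  then show ?thesis
    by (simp add: mink_def power2_norm_eq_inner power_mult_distrib)
      (simp add: power2_eq_square mult.assoc)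
qed

lemma mink_pos_iff_norm: "0 < mink x x \<longleftrightarrow> norm x < sqrt 2 * \<bar>x $ 0\<bar>"
proof -
  have "norm x < sqrt 2 * \<bar>x $ 0\<bar> \<longleftrightarrow> (norm x)\<^sup>2 < (sqrt 2 * \<bar>x $ 0\<bar>)\<^sup>2"
    by (simp flip: not_le)
  then show ?thesis
    by (simp add: mink_def power2_norm_eq_inner power_mult_distrib)
      (simp add: power2_eq_square mult.assoc)
qed

lemma LC_plus_iff_norm: "r \<in> LC_plus \<longleftrightarrow> norm r \<le> sqrt 2 * r $ 0"
proof -
  have "0 \<le> r $ 0" if "norm r \<le> sqrt 2 * r $ 0"
    using order_trans[OF norm_ge_zero that] by (simp add: zero_le_mult_iff)
  then show ?thesis
    by (auto simp: LC_plus_iff_mink mink_nonneg_iff_norm)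
qed

lemma convex_LC_plus: "convex LC_plus"
proof (rule convexI)
  fix x y :: "real ^ 4" and u v :: real
  assume "x \<in> LC_plus" "y \<in> LC_plus" and uv: "0 \<le> u" "0 \<le> v"
  then have "u * norm x \<le> u * (sqrt 2 * x $ 0)" "v * norm y \<le> v * (sqrt 2 * y $ 0)"
    by (auto simp: LC_plus_iff_norm intro: mult_left_mono)
  moreover have "norm (u *\<^sub>R x + v *\<^sub>R y) \<le> u * norm x + v * norm y"
    using uv by (metis abs_of_nonneg norm_scaleR norm_triangle_ineq)
  ultimately show "u *\<^sub>R x + v *\<^sub>R y \<in> LC_plus"
    by (simp add: LC_plus_iff_norm algebra_simps)
qed

lemma LC_plus_time_pos: "r \<in> LC_plus \<Longrightarrow> r \<noteq> 0 \<Longrightarrow> 0 < r $ 0"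
  by (metis LC_plus_iff_norm LC_plus_iff_mink less_le mult_zero_right norm_le_zero_iff)

lemma mink_LC_plus_nonneg:
  assumes "x \<in> LC_plus" "y \<in> LC_plus"
  shows "0 \<le> mink x y"
proof -
  have "x \<bullet> y \<le> norm x * norm y" by (rule norm_cauchy_schwarz)
  also have "\<dots> \<le> (sqrt 2 * x $ 0) * (sqrt 2 * y $ 0)"
    using assms by (intro mult_mono) (auto simp: LC_plus_iff_norm[symmetric] LC_plus_iff_mink)
  also have "\<dots> = 2 * x $ 0 * y $ 0" by simp
  finally show ?thesis by (simp add: mink_def)
qed

text \<open>A timelike \<open>u\<close> separates the two halves of the double cone: for
  \<open>x\<close> in the backward half, Cauchy-Schwarz forces \<open>mink x u < 0\<close>. A null
  \<open>u\<close> would not do, since its negative multiples have product 0 with it.\<close>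

lemma LC_plus_if_mink_timelike:
  assumes u: "u \<in> LC_plus" "0 < mink u u" and x: "0 \<le> mink x x" "0 \<le> mink x u"
  shows "x \<in> LC_plus"
proof (rule ccontr)
  assume "x \<notin> LC_plus"
  with x have neg: "x $ 0 < 0" by (simp add: LC_plus_iff_mink)
  have u': "norm u < sqrt 2 * u $ 0"
    using u by (simp add: mink_pos_iff_norm LC_plus_iff_mink)
  have x': "norm x \<le> sqrt 2 * - (x $ 0)"
    using x neg by (simp add: mink_nonneg_iff_norm)
  have "- (x \<bullet> u) \<le> norm x * norm u"
    using Cauchy_Schwarz_ineq2[of x u] by linarith
  also have "\<dots> \<le> (sqrt 2 * - (x $ 0)) * norm u"
    using x' by (intro mult_right_mono) auto
  also have "\<dots> < (sqrt 2 * - (x $ 0)) * (sqrt 2 * u $ 0)"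
    using u' neg by (intro mult_strict_left_mono) (auto intro: mult_pos_neg)
  also have "\<dots> = - (2 * x $ 0 * u $ 0)" by simp
  finally have "2 * x $ 0 * u $ 0 < x \<bullet> u" by simp
  with x show False by (simp add: mink_def)
qed

text \<open>Preserving \<open>mink\<close> keeps the image in the double cone; the fixed timelike
  vector \<open>u\<close> then pins down the time orientation.\<close>

lemma reflection_LC_plus:
  assumes T: "\<And>x y. mink (T x) (T y) = mink x y"
    and u: "T u = u" "u \<in> LC_plus" "0 < mink u u"
    and x: "x \<in> LC_plus"
  shows "T x \<in> LC_plus"
proof (rule LC_plus_if_mink_timelike[OF u(2,3)])
  show "0 \<le> mink (T x) (T x)" using x by (simp add: T LC_plus_iff_mink)
  show "0 \<le> mink (T x) u" by (metis T u(1,2) x mink_LC_plus_nonneg)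
qed

text \<open>Combined by \<open>eventually_conj\<close>, instances of this give one small step
  \<open>t > 0\<close> at which several strict inequalities survive together.\<close>

lemma eventually_perturbation_pos:
  fixes a c :: real
  assumes "0 < a"
  shows "eventually (\<lambda>t. 0 < a + t * c) (at_right 0)"
proof -
  have "((\<lambda>t. a + t * c) \<longlongrightarrow> a + 0 * c) (at_right 0)" by (intro tendsto_intros)
  with assms show ?thesis by (intro order_tendstoD) auto
qed

section \<open>Expansion of the potential and first-order conditions at a minimum\<close>

lemma linear_form_inner: "linear_form M r = M \<bullet> r"
  by (simp add: linear_form_def inner_vec_def)

lemma quadratic_form_inner: "quadratic_form \<Lambda> r = r \<bullet> (\<Lambda> *v r)"
  by (simp add: quadratic_form_def inner_vec_def matrix_vector_mult_def sum_distrib_left ac_simps)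

lemma inner_symmetric_matrix:
  fixes A :: "real ^ 'n ^ 'n"
  assumes "transpose A = A"
  shows "x \<bullet> (A *v y) = y \<bullet> (A *v x)"
  by (metis assms dot_lmul_matrix inner_commute transpose_matrix_vector)

lemma matrix_vector_simps:
  fixes A :: "real ^ 'n ^ 'm"
  shows "A *v (x + y) = A *v x + A *v y" "A *v (x - y) = A *v x - A *v y"
    "A *v (c *\<^sub>R x) = c *\<^sub>R (A *v x)" "A *v 0 = 0"
  by (simp_all add: matrix_vector_right_distrib matrix_vector_mult_diff_distrib
      matrix_vector_mult_scaleR)

lemma potential_expand:
  assumes "transpose \<Lambda> = \<Lambda>"
  shows "potential M \<Lambda> (r + t *\<^sub>R h) =
    potential M \<Lambda> r + t * ((\<Lambda> *v r - M) \<bullet> h) + t\<^sup>2 / 2 * quadratic_form \<Lambda> h"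
  using inner_symmetric_matrix[OF assms, of r h]
  by (simp add: potential_def linear_form_inner quadratic_form_inner matrix_vector_simps inner_simps
      inner_commute[of h] inner_commute[of r] field_simps power2_eq_square)

lemma vacuaD:
  assumes "r \<in> vacua M \<Lambda>"
  shows "r \<in> LC_plus" and "s \<in> LC_plus \<Longrightarrow> potential M \<Lambda> r \<le> potential M \<Lambda> s"
  using assms by (auto simp: vacua_def is_arg_min_linorder)

lemma vacuaI:
  assumes "r \<in> vacua M \<Lambda>" "s \<in> LC_plus" "potential M \<Lambda> s = potential M \<Lambda> r"
  shows "s \<in> vacua M \<Lambda>"
  using assms by (auto simp: vacua_def is_arg_min_linorder)

text \<open>The condition on \<open>h\<close> says that it points strictly into the cone at
  \<open>r\<close>, so a negative slope along \<open>h\<close> would yield a lower admissible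
  point.\<close>

lemma potential_gradient_nonneg:
  assumes sym: "transpose \<Lambda> = \<Lambda>" and r: "r \<in> vacua M \<Lambda>" "0 \<le> mink r r" "0 < r $ 0"
    and h: "0 < mink r h"
  shows "0 \<le> (\<Lambda> *v r - M) \<bullet> h"
proof (rule ccontr)
  assume "\<not> ?thesis"
  then have "0 < - ((\<Lambda> *v r - M) \<bullet> h)" by simp
  \<comment> \<open>The middle conditions keep \<open>r + t *\<^sub>R h\<close> in the cone; the
    last lets the linear decrease outweigh the quadratic term.\<close>
  then have "eventually (\<lambda>t. 0 < t \<and> 0 < r $ 0 + t * h $ 0 \<and> 0 < 2 * mink r h + t * mink h h
      \<and> 0 < - ((\<Lambda> *v r - M) \<bullet> h) + t * (- quadratic_form \<Lambda> h / 2)) (at_right 0)"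
    using h r(3) by (intro eventually_conj eventually_perturbation_pos eventually_at_right_less)
      simp_all
  from eventually_happens'[OF _ this]
  obtain t where t: "0 < t" "0 < r $ 0 + t * h $ 0" "0 < 2 * mink r h + t * mink h h"
    and desc: "0 < - ((\<Lambda> *v r - M) \<bullet> h) + t * (- quadratic_form \<Lambda> h / 2)"
    by auto
  have "mink (r + t *\<^sub>R h) (r + t *\<^sub>R h) = mink r r + t * (2 * mink r h + t * mink h h)"
    by (simp add: mink_simps mink_commute[of h r] algebra_simps)
  moreover have "0 < t * (2 * mink r h + t * mink h h)"
    using t by simp
  ultimately have "r + t *\<^sub>R h \<in> LC_plus"
    using r(2) t(2) by (simp add: LC_plus_iff_mink)
  then have "potential M \<Lambda> r \<le> potential M \<Lambda> (r + t *\<^sub>R h)"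
    using vacuaD[OF r(1)] by blast
  then have "t * (- ((\<Lambda> *v r - M) \<bullet> h) + t * (- quadratic_form \<Lambda> h / 2)) \<le> 0"
    by (simp add: potential_expand[OF sym] algebra_simps power2_eq_square)
  moreover have "0 < t * (- ((\<Lambda> *v r - M) \<bullet> h) + t * (- quadratic_form \<Lambda> h / 2))"
    using t(1) desc by (rule mult_pos_pos)
  ultimately show False by linarith
qed

text \<open>The gradient is nonnegative on the open half-space \<open>0 < mink r h\<close>, hence by
  perturbation on the bounding hyperplane. That is closed under negation, so the gradient vanishes
  on it and is a multiple of \<open>mink r\<close>.\<close>

lemma lagrange_multiplier:
  assumes sym: "transpose \<Lambda> = \<Lambda>" and r: "r \<in> vacua M \<Lambda>" "0 \<le> mink r r" "0 < r $ 0"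
  obtains l where "\<And>h. (\<Lambda> *v r - M) \<bullet> h = l * mink r h"
proof -
  define w where "w = \<Lambda> *v r - M"
  \<comment> \<open>The time axis is transverse to the hyperplane because
    \<open>0 < r $ 0\<close>.\<close>
  define u :: "real ^ 4" where "u = axis 0 1"
  have u: "mink r u = r $ 0"
    by (simp add: mink_def u_def inner_axis axis_nth)
  have null: "0 \<le> w \<bullet> h" if "mink r h = 0" for h
  proof (rule ccontr)
    assume "\<not> ?thesis"
    then have "eventually (\<lambda>t. 0 < t \<and> 0 < - (w \<bullet> h) + t * - (w \<bullet> u)) (at_right 0)"
      by (intro eventually_conj eventually_perturbation_pos eventually_at_right_less)
      simp_all
    from eventually_happens'[OF _ this]
    obtain t where t: "0 < t" "w \<bullet> h + t * (w \<bullet> u) < 0" by auto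
    have "0 < mink r (h + t *\<^sub>R u)"
      using t r(3) that by (simp add: mink_simps u)
    from potential_gradient_nonneg[OF sym r this] show False
      using t(2) by (simp add: w_def[symmetric] inner_simps)
  qed
  have "w \<bullet> h = (w \<bullet> u) / r $ 0 * mink r h" for h
  proof -
    define k where "k = h - (mink r h / r $ 0) *\<^sub>R u"
    have k: "mink r k = 0" "mink r (- k) = 0"
      using r(3) by (simp_all add: k_def mink_simps u)
    have "w \<bullet> k = 0" using null[OF k(1)] null[OF k(2)] by simp
    then show ?thesis by (simp add: k_def inner_simps)
  qed
  then show thesis using that w_def by blast
qed

section \<open>Position of two isolated minima on the cone\<close>

lemma isolated_vacua_line:
  assumes sym: "transpose \<Lambda> = \<Lambda>" and vac: "vacua M \<Lambda> = {r, r'}" "r \<noteq> r'"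
  shows "0 < (\<Lambda> *v r - M) \<bullet> (r' - r)" and "0 < s \<Longrightarrow> r - s *\<^sub>R (r' - r) \<notin> LC_plus"
proof -
  define d where "d = r' - r"
  define b where "b = (\<Lambda> *v r - M) \<bullet> d"
  have r: "r \<in> vacua M \<Lambda>" and r': "r' \<in> vacua M \<Lambda>" using vac by auto
  note L = vacuaD(1)[OF r] vacuaD(1)[OF r']
  have eq: "potential M \<Lambda> r = potential M \<Lambda> r'"
    using vacuaD(2)[OF r L(2)] vacuaD(2)[OF r' L(1)] by simp
  have "potential M \<Lambda> (r + 1 *\<^sub>R d) = potential M \<Lambda> r"
    using eq by (simp add: d_def)
  \<comment> \<open>Equal values at \<open>t = 0\<close> and \<open>t = 1\<close> fix the
    second-order coefficient, leaving the profile \<open>b * (t * (1 - t))\<close>.\<close>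
  then have quad: "quadratic_form \<Lambda> d = - 2 * b"
    unfolding potential_expand[OF sym] by (simp add: b_def)
  then have f: "potential M \<Lambda> (r + t *\<^sub>R d) = potential M \<Lambda> r + b * (t * (1 - t))" for t
    unfolding potential_expand[OF sym] b_def[symmetric] quad
    by (simp add: power2_eq_square algebra_simps)
  have mid: "r + (1/2) *\<^sub>R d = (1/2) *\<^sub>R r + (1/2) *\<^sub>R r'"
    by (simp add: d_def vec_eq_iff field_simps)
  then have in_LC: "r + (1/2) *\<^sub>R d \<in> LC_plus"
    using convexD[OF convex_LC_plus L, of "1/2" "1/2"] by simp
  have "r + (1/2) *\<^sub>R d \<noteq> r" "r + (1/2) *\<^sub>R d \<noteq> r'"
    using vac(2) by (auto simp: d_def vec_eq_iff field_simps) metis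
  \<comment> \<open>For \<open>b = 0\<close> the midpoint would be a third minimum.\<close>
  then have "b \<noteq> 0"
    using vacuaI[OF r in_LC] vac(1) f[of "1/2"] by auto
  moreover have "0 \<le> b"
    using vacuaD(2)[OF r in_LC] f[of "1/2"] by simp
  ultimately have b: "0 < b" by simp
  then show "0 < (\<Lambda> *v r - M) \<bullet> (r' - r)" by (simp add: b_def d_def)
  assume s: "0 < s"
  have "0 < b * (s * (1 + s))" using s b by (intro mult_pos_pos) auto
  then have "potential M \<Lambda> (r - s *\<^sub>R d) < potential M \<Lambda> r"
    using f[of "- s"] by simp
  then show "r - s *\<^sub>R (r' - r) \<notin> LC_plus"
    using vacuaD(2)[OF r] unfolding d_def by fastforce
qed

lemma isolated_vacuum_nonzero:
  assumes sym: "transpose \<Lambda> = \<Lambda>"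
    and pos: "\<And>r. r \<in> LC_plus - {0} \<Longrightarrow> quadratic_form \<Lambda> r > 0"
    and vac: "vacua M \<Lambda> = {r, r'}" "r \<noteq> r'"
  shows "r \<noteq> 0"
proof
  assume 0: "r = 0"
  have r: "r \<in> vacua M \<Lambda>" and r': "r' \<in> vacua M \<Lambda>" using vac by auto
  have "potential M \<Lambda> r' \<le> potential M \<Lambda> r"
    using vacuaD[OF r] vacuaD[OF r'] by blast
  then have "- (M \<bullet> r') + quadratic_form \<Lambda> r' / 2 \<le> 0"
    by (simp add: 0 potential_def linear_form_inner quadratic_form_inner)
  moreover have "0 < - (M \<bullet> r')"
    using isolated_vacua_line(1)[OF sym vac] by (simp add: 0 matrix_vector_simps)
  moreover have "0 < quadratic_form \<Lambda> r'"
    using pos[of r'] vacuaD(1)[OF r'] vac(2) 0 by auto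
  ultimately show False by linarith
qed

lemma isolated_vacuum_null:
  assumes sym: "transpose \<Lambda> = \<Lambda>" and vac: "vacua M \<Lambda> = {r, r'}" "r \<noteq> r'" and nz: "r \<noteq> 0"
  shows "mink r r = 0"
proof (rule ccontr)
  assume "mink r r \<noteq> 0"
  define d where "d = r' - r"
  have r: "r \<in> LC_plus" using vac vacuaD(1) by blast
  with \<open>mink r r \<noteq> 0\<close> have "norm r < sqrt 2 * r $ 0"
    using mink_pos_iff_norm[of r] by (auto simp: LC_plus_iff_mink)
  then have "0 < sqrt 2 * r $ 0 - norm r" by simp
  \<comment> \<open>By the triangle inequality the affine expression bounds the slack of
    \<open>r - t *\<^sub>R d\<close> in the norm form of the cone condition from below.\<close>
  then have "eventually (\<lambda>t. 0 < t \<and>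
      0 < sqrt 2 * r $ 0 - norm r + t * (- (sqrt 2 * d $ 0) - norm d)) (at_right 0)"
    by (intro eventually_conj eventually_perturbation_pos eventually_at_right_less)
  from eventually_happens'[OF _ this]
  obtain t where t: "0 < t" "0 < sqrt 2 * r $ 0 - norm r + t * (- (sqrt 2 * d $ 0) - norm d)"
    by auto
  have "norm (r - t *\<^sub>R d) \<le> norm r + t * norm d"
    using norm_triangle_ineq4[of r "t *\<^sub>R d"] t(1) by simp
  then have "r - t *\<^sub>R d \<in> LC_plus"
    using t(2) by (simp add: LC_plus_iff_norm algebra_simps)
  then show False
    using isolated_vacua_line(2)[OF sym vac t(1)] d_def by blast
qed

text \<open>Otherwise the line could be continued backwards past \<open>r\<close> within the cone:
  for null endpoints, \<open>mink\<close> at \<open>r - t *\<^sub>R d\<close> is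
  \<open>- 2 * t * (1 + t) * mink r r'\<close>.\<close>

lemma isolated_vacua_mink_pos:
  assumes sym: "transpose \<Lambda> = \<Lambda>" and vac: "vacua M \<Lambda> = {r, r'}" "r \<noteq> r'"
    and null: "mink r r = 0" "mink r' r' = 0" and nz: "r \<noteq> 0"
  shows "0 < mink r r'"
proof (rule ccontr)
  assume neg: "\<not> ?thesis"
  define d where "d = r' - r"
  have r: "r \<in> LC_plus" using vac vacuaD(1) by blast
  have "eventually (\<lambda>t. 0 < t \<and> 0 < r $ 0 + t * - (d $ 0)) (at_right 0)"
    using LC_plus_time_pos[OF r nz]
    by (intro eventually_conj eventually_perturbation_pos eventually_at_right_less)
      simp_all
  from eventually_happens'[OF _ this]
  obtain t where t: "0 < t" "0 < r $ 0 - t * d $ 0" by auto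
  have "mink (r - t *\<^sub>R d) (r - t *\<^sub>R d) = 2 * (t * (1 + t)) * (- mink r r')"
    by (simp add: d_def mink_simps null mink_commute[of r' r] algebra_simps)
  moreover have "0 \<le> \<dots>"
    using neg t(1) by (intro mult_nonneg_nonneg) auto
  ultimately have "r - t *\<^sub>R d \<in> LC_plus"
    using t(2) by (simp add: LC_plus_iff_mink)
  then show False
    using isolated_vacua_line(2)[OF sym vac t(1)] d_def by blast
qed

section \<open>The reflection exchanging the two minima\<close>

theorem proposition4:
  fixes M :: "real ^ 4" and \<Lambda> :: "real ^ 4 ^ 4" and r\<^sub>1 r\<^sub>2 :: "real ^ 4"
  assumes symmetric: "transpose \<Lambda> = \<Lambda>"
    and positive: "\<And>r. r \<in> LC_plus - {0} \<Longrightarrow> quadratic_form \<Lambda> r > 0"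
    and twice_degenerate: "vacua M \<Lambda> = {r\<^sub>1, r\<^sub>2}" "r\<^sub>1 \<noteq> r\<^sub>2"
  shows "\<exists>T. explicit_symmetry M \<Lambda> T \<and> T \<noteq> id \<and> T \<circ> T = id \<and>
           spontaneously_violated M \<Lambda> T r\<^sub>1 \<and> spontaneously_violated M \<Lambda> T r\<^sub>2 \<and>
           T r\<^sub>1 = r\<^sub>2 \<and> T r\<^sub>2 = r\<^sub>1"
proof -
  have vac': "vacua M \<Lambda> = {r\<^sub>2, r\<^sub>1}" "r\<^sub>2 \<noteq> r\<^sub>1" using twice_degenerate by auto
  have v: "r\<^sub>1 \<in> vacua M \<Lambda>" "r\<^sub>2 \<in> vacua M \<Lambda>" using twice_degenerate by auto
  note L = v[THEN vacuaD(1)]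
  have nz: "r\<^sub>1 \<noteq> 0" "r\<^sub>2 \<noteq> 0"
    using isolated_vacuum_nonzero[OF symmetric positive twice_degenerate]
      isolated_vacuum_nonzero[OF symmetric positive vac'] by auto
  have null: "mink r\<^sub>1 r\<^sub>1 = 0" "mink r\<^sub>2 r\<^sub>2 = 0"
    using isolated_vacuum_null[OF symmetric twice_degenerate nz(1)]
      isolated_vacuum_null[OF symmetric vac' nz(2)] by auto
  have g: "0 < mink r\<^sub>1 r\<^sub>2"
    using isolated_vacua_mink_pos[OF symmetric twice_degenerate null nz(1)] .
  obtain l where l: "\<And>h. (\<Lambda> *v r\<^sub>1 - M) \<bullet> h = l * mink r\<^sub>1 h"
    using lagrange_multiplier[OF symmetric v(1)] null LC_plus_time_pos[OF L(1) nz(1)] by auto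
  obtain l' where l': "\<And>h. (\<Lambda> *v r\<^sub>2 - M) \<bullet> h = l' * mink r\<^sub>2 h"
    using lagrange_multiplier[OF symmetric v(2)] null LC_plus_time_pos[OF L(2) nz(2)] by auto
  \<comment> \<open>Contracting each stationarity condition with its own null minimum kills the
    multiplier term, so the potential there is \<open>- (M \<bullet> r) / 2\<close>.\<close>
  have euler: "quadratic_form \<Lambda> r\<^sub>1 = M \<bullet> r\<^sub>1" "quadratic_form \<Lambda> r\<^sub>2 = M \<bullet> r\<^sub>2"
    using l[of r\<^sub>1] l'[of r\<^sub>2] null
    by (simp_all add: quadratic_form_inner inner_diff_left inner_commute[of r\<^sub>1 "\<Lambda> *v r\<^sub>1"]
        inner_commute[of r\<^sub>2 "\<Lambda> *v r\<^sub>2"])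
  have "potential M \<Lambda> r\<^sub>1 = potential M \<Lambda> r\<^sub>2"
    using vacuaD(2)[OF v(1) L(2)] vacuaD(2)[OF v(2) L(1)] by simp
  then have M: "M \<bullet> r\<^sub>1 = M \<bullet> r\<^sub>2"
    by (simp add: potential_def linear_form_inner euler)
  have "l * mink r\<^sub>1 r\<^sub>2 = l' * mink r\<^sub>1 r\<^sub>2"
    using l[of r\<^sub>2] l'[of r\<^sub>1] M inner_symmetric_matrix[OF symmetric, of r\<^sub>1 r\<^sub>2]
    by (simp add: inner_diff_left mink_commute[of r\<^sub>2 r\<^sub>1] inner_commute[of "_ *v _"])
  then have "l' = l" using g by simp

  define d where "d = r\<^sub>2 - r\<^sub>1"
  have \<Lambda>d: "(\<Lambda> *v d) \<bullet> h = l * mink d h" for h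
    using l[of h] l'[of h] \<open>l' = l\<close>
    by (simp add: d_def matrix_vector_simps inner_diff_left mink_simps algebra_simps)
  have Md: "M \<bullet> d = 0" using M by (simp add: d_def inner_diff_right)
  have dd: "mink d d = - 2 * mink r\<^sub>1 r\<^sub>2"
    by (simp add: d_def mink_simps null mink_commute[of r\<^sub>2 r\<^sub>1])
  with g have dd0: "mink d d \<noteq> 0" by simp
  \<comment> \<open>\<open>T\<close> is the Minkowski reflection along \<open>d\<close>, well
    defined since \<open>mink d d < 0\<close>.\<close>
  define c where "c x = 2 * mink x d / mink d d" for x
  define T where "T x = x - c x *\<^sub>R d" for x
  have cT: "c (T x) = - c x" for x
    using dd0 by (simp add: c_def T_def mink_simps field_simps)
  have TT: "T (T x) = x" for x
    using cT[of x] by (simp add: T_def[of "T x"]) (simp add: T_def)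
  have c_mink: "c x * mink d d = 2 * mink x d" for x
    using dd0 by (simp add: c_def)
  have iso: "mink (T x) (T y) = mink x y" for x y
  proof -
    have "mink (T x) (T y) = mink x y - c y * mink x d - c x * mink y d + c x * (c y * mink d d)"
      by (simp add: T_def mink_simps mink_commute[of d y] algebra_simps)
    also have "c x * (c y * mink d d) = c x * mink y d + c y * mink x d"
      using c_mink[of x] c_mink[of y] by algebra
    finally show ?thesis by simp
  qed
  \<comment> \<open>By nullness \<open>mink r\<^sub>1 d = mink r\<^sub>1 r\<^sub>2\<close>, which is
    minus half of \<open>mink d d\<close>; for \<open>r\<^sub>2\<close> the sign flips.\<close>
  have "c r\<^sub>1 = - 1" "c r\<^sub>2 = 1"
    using g unfolding c_def dd by (simp_all add: d_def mink_simps null mink_commute[of r\<^sub>2 r\<^sub>1])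
  then have Tr: "T r\<^sub>1 = r\<^sub>2" "T r\<^sub>2 = r\<^sub>1"
    by (simp_all add: T_def d_def)
  have lin: "linear T"
    by (rule linearI)
      (simp_all add: T_def c_def mink_simps add_divide_distrib algebra_simps)
  have bij: "bij T" by (rule o_bij[of T]) (auto simp: TT fun_eq_iff)
  \<comment> \<open>The sum of the minima is the fixed timelike vector, as \<open>T\<close> swaps
    the summands.\<close>
  have "T x \<in> LC_plus" if "x \<in> LC_plus" for x
  proof (rule reflection_LC_plus[OF iso _ _ _ that])
    show "T (r\<^sub>1 + r\<^sub>2) = r\<^sub>1 + r\<^sub>2" by (simp add: linear_add[OF lin] Tr)
    show "0 < mink (r\<^sub>1 + r\<^sub>2) (r\<^sub>1 + r\<^sub>2)"
      using g by (simp add: mink_simps null mink_commute[of r\<^sub>2 r\<^sub>1])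
    then show "r\<^sub>1 + r\<^sub>2 \<in> LC_plus"
      using L by (simp add: LC_plus_iff_mink)
  qed
  then have LC: "T ` LC_plus = LC_plus"
    by (metis TT image_subsetI subset_antisym image_eqI subsetI)
  have quad: "quadratic_form \<Lambda> (T x) = quadratic_form \<Lambda> x" for x
  proof -
    \<comment> \<open>Since \<open>\<Lambda>\<close> acts on \<open>d\<close> as \<open>l\<close>
      times the metric, the change is the one that \<open>mink x x\<close> would undergo, scaled by
      \<open>l\<close>, hence zero.\<close>
    have "quadratic_form \<Lambda> (T x) =
        quadratic_form \<Lambda> x - 2 * c x * ((\<Lambda> *v d) \<bullet> x) + c x * c x * ((\<Lambda> *v d) \<bullet> d)"
      using inner_symmetric_matrix[OF symmetric, of d x]
      by (simp add: T_def quadratic_form_inner matrix_vector_simps inner_simps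
          inner_commute[of "_ *v _"] algebra_simps)
    also have "\<dots> = quadratic_form \<Lambda> x - l * c x * (2 * mink x d - c x * mink d d)"
      by (simp add: \<Lambda>d mink_commute[of d x] algebra_simps)
    finally show ?thesis by (simp add: c_mink)
  qed
  have "linear_form M (T x) = linear_form M x" for x
    by (simp add: linear_form_inner T_def inner_diff_right Md)
  with lin bij LC quad have "explicit_symmetry M \<Lambda> T"
    by (simp add: explicit_symmetry_def)
  moreover have "T \<noteq> id" using Tr(1) vac'(2) by auto
  moreover have "T \<circ> T = id" by (auto simp: TT fun_eq_iff)
  ultimately show ?thesis
    using Tr v vac'(2) by (intro exI[of _ T]) (auto simp: spontaneously_violated_def)
qed

end
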